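(* Let $(X, N, \phi, K, * )$ be a finite dimensional fuzzy strong $\phi$-b-normed linear space over $\mathbb{R}$ in which the underlying $t$-norm $*$ is continuous at $(1,1)$. Then a subset $A$ of $X$ is compact if and only if $A$ is closed and bounded.
   Context: A $t$-norm is a binary operation $* : [0,1] \times [0,1] \to [0,1]$ that is associative and commutative, satisfies $\alpha * 1 = \alpha$ for all $\alpha \in [0,1]$, and satisfies $\alpha * \gamma \leq \beta * \delta$ whenever $\alpha \leq \beta$ and $\gamma \leq \delta$. Let $\phi : \mathbb{R} \to \mathbb{R}$ be a function with the following properties: ($\phi$1) $\phi(-t) = \phi(t)$ for all $t \in \mathbb{R}$; ($\phi$2) $\phi(1) = 1$; ($\phi$3) $\phi$ is strictly increasing and continuous on $(0,\infty)$; ($\phi$4) $\lim_{\alpha \to 0} \phi(\alpha) = 0$ and $\lim_{\alpha \to \infty} \phi(\alpha) = \infty$. Let $X$ be a real linear space with zero vector $\theta$, let $K \geq 1$ be a given real number, and let $*$ be a $t$-norm. A fuzzy subset $N$ of $X \times \mathbb{R}$ (that is, a function $N : X \times \mathbb{R} \to [0,1]$) is called a fuzzy strong $\phi$-b-norm on $X$ if for all $x, y \in X$: (bN1) $N(x,t) = 0$ for all $t \in \mathbb{R}$ with $t \leq 0$; (bN2) ($N(x,t) = 1$ for all $t > 0$) if and only if $x = \theta$; (bN3) for all $t > 0$ and all scalars $c \in \mathbb{R}$ with $\phi(c) \neq 0$, $N(cx,t) = N\left(x, \frac{t}{\phi(c)}\right)$; (bN4) for all $s,t \in \mathbb{R}$,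 $N(x+y, s+Kt) \geq N(x,s) * N(y,t)$; (bN5) $N(x,\cdot)$ is a non-decreasing function of $t$ and $\lim_{t \to \infty} N(x,t) = 1$. Then $(X, N, \phi, K, * )$ is called a fuzzy strong $\phi$-b-normed linear space; it is finite dimensional if $X$ is finite dimensional as a linear space. A sequence $\{x_n\}$ in $X$ converges to $x \in X$ if $\lim_{n \to \infty} N(x_n - x, t) = 1$ for all $t > 0$. A subset $A \subseteq X$ is closed if whenever a sequence $\{x_n\}$ in $A$ converges to $x \in X$, then $x \in A$. A subset $A \subseteq X$ is compact if every sequence in $A$ has a subsequence converging to an element of $A$. A subset $A \subseteq X$ is (fuzzy) bounded if for each $r$ with $0 < r < 1$ there exists $t > 0$ such that $N(x,t) > 1 - r$ for all $x \in A$. *)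

theory Defs
  imports "HOL-Analysis.Analysis"
begin

text \<open>
  A t-norm is an operation on the unit interval; it is represented by a total function on the
  reals of which only the values on \<open>{0..1}\<close> are constrained.
\<close>

locale t_norm =
  fixes T :: "real \<Rightarrow> real \<Rightarrow> real"
  assumes T_closed: "\<lbrakk>a \<in> {0..1}; b \<in> {0..1}\<rbrakk> \<Longrightarrow> T a b \<in> {0..1}"
    and T_assoc: "\<lbrakk>a \<in> {0..1}; b \<in> {0..1}; c \<in> {0..1}\<rbrakk> \<Longrightarrow> T (T a b) c = T a (T b c)"
    and T_commute: "\<lbrakk>a \<in> {0..1}; b \<in> {0..1}\<rbrakk> \<Longrightarrow> T a b = T b a"
    and T_one: "a \<in> {0..1} \<Longrightarrow> T a 1 = a"
    and T_mono: "\<lbrakk>a \<in> {0..1}; b \<in> {0..1}; c \<in> {0..1}; d \<in> {0..1}; a \<le> b; c \<le> d\<rbrakk>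
      \<Longrightarrow> T a c \<le> T b d"

text \<open>The value \<open>\<phi> 0\<close> is left unconstrained: the limit at 0 is the punctured one.\<close>

locale phi_function =
  fixes \<phi> :: "real \<Rightarrow> real"
  assumes phi_even: "\<phi> (- t) = \<phi> t"
    and phi_one: "\<phi> 1 = 1"
    and phi_strict_mono: "strict_mono_on {0<..} \<phi>"
    and phi_continuous: "continuous_on {0<..} \<phi>"
    and phi_lim_0: "(\<phi> \<longlongrightarrow> 0) (at 0)"
    and phi_lim_infinity: "filterlim \<phi> at_top at_top"

locale fuzzy_strong_phi_b_normed_space = t_norm T + phi_function \<phi>
  for N :: "'a::real_vector \<Rightarrow> real \<Rightarrow> real"
    and \<phi> :: "real \<Rightarrow> real"
    and K :: real
    and T :: "real \<Rightarrow> real \<Rightarrow> real" +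
  assumes K_ge_1: "K \<ge> 1"
    and N_range: "N x t \<in> {0..1}"
    and bN1: "t \<le> 0 \<Longrightarrow> N x t = 0"
    and bN2: "(\<forall>t>0. N x t = 1) \<longleftrightarrow> x = 0"
    and bN3: "\<lbrakk>t > 0; \<phi> c \<noteq> 0\<rbrakk> \<Longrightarrow> N (c *\<^sub>R x) t = N x (t / \<phi> c)"
    and bN4: "N (x + y) (s + K * t) \<ge> T (N x s) (N y t)"
    and bN5_mono: "mono (N x)"
    and bN5_lim: "(N x \<longlongrightarrow> 1) at_top"

definition fuzzy_converges_to ::
    "('a::real_vector \<Rightarrow> real \<Rightarrow> real) \<Rightarrow> (nat \<Rightarrow> 'a) \<Rightarrow> 'a \<Rightarrow> bool" where
  "fuzzy_converges_to N X x \<longleftrightarrow> (\<forall>t>0. (\<lambda>n. N (X n - x) t) \<longlonglongrightarrow> 1)"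

definition fuzzy_closed :: "('a::real_vector \<Rightarrow> real \<Rightarrow> real) \<Rightarrow> 'a set \<Rightarrow> bool" where
  "fuzzy_closed N A \<longleftrightarrow>
     (\<forall>X x. (\<forall>n. X n \<in> A) \<and> fuzzy_converges_to N X x \<longrightarrow> x \<in> A)"

definition fuzzy_compact :: "('a::real_vector \<Rightarrow> real \<Rightarrow> real) \<Rightarrow> 'a set \<Rightarrow> bool" where
  "fuzzy_compact N A \<longleftrightarrow>
     (\<forall>X :: nat \<Rightarrow> 'a. (\<forall>n. X n \<in> A) \<longrightarrow>
        (\<exists>x\<in>A. \<exists>r :: nat \<Rightarrow> nat. strict_mono r \<and> fuzzy_converges_to N (X \<circ> r) x))"

definition fuzzy_bounded :: "('a::real_vector \<Rightarrow> real \<Rightarrow> real) \<Rightarrow> 'a set \<Rightarrow> bool" where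
  "fuzzy_bounded N A \<longleftrightarrow> (\<forall>r. 0 < r \<and> r < 1 \<longrightarrow> (\<exists>t>0. \<forall>x\<in>A. N x t > 1 - r))"

end

theory Submission
  imports Defs
begin

text \<open>
  Continuity of the t-norm at \<open>(1, 1)\<close> makes addition sequentially continuous and limits unique, and
  the limit of \<open>\<phi>\<close> at 0 makes \<open>c \<mapsto> c x\<close> continuous; hence convergence of the coordinates in
  a finite basis implies fuzzy convergence. If the coordinates of points \<open>x\<^sub>n\<close> of a fuzzy bounded set
  had \<open>\<ell>\<^sup>1\<close>-norms \<open>a\<^sub>n \<rightarrow> \<infinity>\<close>, then \<open>x\<^sub>n / a\<^sub>n\<close> would converge to 0 because
  \<open>\<phi>(a\<^sub>n) \<rightarrow> \<infinity>\<close>, while a subsequence converges coordinatewise to a point whose coordinates have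
  \<open>\<ell>\<^sup>1\<close>-norm 1, contradicting uniqueness. So bounded sets have bounded coordinates, and
  Bolzano--Weierstrass applies.
\<close>

section \<open>Subsequences and coordinates in a finite basis\<close>

lemma fuzzy_converges_to_subseq:
  assumes "fuzzy_converges_to N X x" "strict_mono r"
  shows "fuzzy_converges_to N (X \<circ> r) x"
  using assms LIMSEQ_subseq_LIMSEQ unfolding fuzzy_converges_to_def by (fastforce simp: o_def)

text \<open>Bolzano-Weierstrass for finitely many coordinate functionals. It is independent of
  \<open>N\<close>, so it serves both for the normalised sequence in the boundedness argument and
  for a sequence in \<open>A\<close>.\<close>

lemma bounded_representation_subseq:
  fixes X :: "nat \<Rightarrow> 'a::real_vector"
  assumes B: "finite B" "independent B" "span B = UNIV"
    and M: "\<And>n. (\<Sum>b\<in>B. \<bar>representation B (X n) b\<bar>) \<le> M"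
  obtains x r where "strict_mono r"
    "\<And>b. b \<in> B \<Longrightarrow> (\<lambda>n. representation B (X (r n)) b) \<longlonglongrightarrow> representation B x b"
proof -
  \<comment> \<open>The inverse of the coordinate map, through which
    \<open>compact_lemma_general\<close> turns limit coordinates back into a vector.\<close>
  define unproj where "unproj g = (\<Sum>b\<in>B. g b *\<^sub>R b)" for g :: "'a \<Rightarrow> real"
  have "bounded ((\<lambda>x. representation B x b) ` range X)" if "b \<in> B" for b
  proof -
    have "\<bar>representation B (X n) b\<bar> \<le> M" for n
      using member_le_sum[OF \<open>b \<in> B\<close>, of "\<lambda>b. \<bar>representation B (X n) b\<bar>"] B(1) M[of n] by simp
    then show ?thesis
      by (auto simp: bounded_iff)
  qed
  moreover have "representation B (unproj g) b = g b" if "b \<in> B" for g b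
    using B that
    by (simp add: unproj_def real_vector.representation_sum real_vector.representation_scale
        real_vector.representation_basis if_distrib sum.delta' cong: if_cong)
  moreover have "unproj (\<lambda>b. representation B x b) = x" for x
    using B by (simp add: unproj_def real_vector.sum_representation_eq)
  ultimately obtain x r where "strict_mono r"
    "\<And>e. e > 0 \<Longrightarrow> eventually (\<lambda>n. \<forall>b\<in>B. dist (representation B (X (r n)) b) (representation B x b) < e) sequentially"
    using compact_lemma_general[OF B(1), of "representation B" X unproj] by blast
  then show ?thesis
    by (intro that[of r x] tendstoI) (force elim: eventually_mono)+
qed

section \<open>Positivity of \<phi> away from 0\<close>

context phi_function
begin

text \<open>For positive \<open>c\<close>, monotonicity bounds \<phi> near 0 by
  \<open>\<phi> (c / 2)\<close>, so the limit 0 yields only a non-strict inequality at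
  \<open>c / 2\<close>; strict growth from \<open>c / 2\<close> to \<open>c\<close> makes it strict.
  Evenness covers negative \<open>c\<close>.\<close>

lemma phi_pos:
  assumes "c \<noteq> 0"
  shows "\<phi> c > 0"
proof -
  have pos: "\<phi> c > 0" if c: "c > 0" for c :: real
  proof -
    have "(\<phi> \<longlongrightarrow> 0) (at_right 0)"
      using phi_lim_0 by (rule filterlim_mono) (auto intro: at_le)
    moreover have "eventually (\<lambda>u. \<phi> u \<le> \<phi> (c / 2)) (at_right 0)"
      using eventually_at_right_less[of 0]
        eventually_at_right_real[of 0 "c / 2"] c
      by (auto elim!: eventually_mono simp: less_imp_le strict_mono_onD[OF phi_strict_mono])
    ultimately have "0 \<le> \<phi> (c / 2)"
      by (intro tendsto_upperbound) auto
    also have "\<phi> (c / 2) < \<phi> c"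
      using c by (intro strict_mono_onD[OF phi_strict_mono]) auto
    finally show ?thesis .
  qed
  show ?thesis
    using pos[of c] pos[of "- c"] assms phi_even[of c] by (cases "c > 0") auto
qed

end

section \<open>Scalar multiples and fuzzy convergence\<close>

context fuzzy_strong_phi_b_normed_space
begin

lemma N_le_1: "N x t \<le> 1"
  using N_range[of x t] by auto

lemma N_mono: "s \<le> t \<Longrightarrow> N x s \<le> N x t"
  using bN5_mono[of x] by (auto dest: monoD)

lemma N_zero: "t > 0 \<Longrightarrow> N 0 t = 1"
  using bN2[of 0] by auto

lemma N_minus: "t > 0 \<Longrightarrow> N (- x) t = N x t"
  using bN3[of t "- 1" x] phi_even[of 1] phi_one by simp

text \<open>By \<open>bN3\<close> a small scalar turns \<open>t\<close> into
  \<open>t / \<phi> c\<close>, which tends to infinity, where \<open>N x\<close> tends to 1.\<close>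

lemma tendsto_N_scaleR:
  assumes t: "t > 0" and a: "(a \<longlongrightarrow> 0) F"
  shows "((\<lambda>n. N (a n *\<^sub>R x) t) \<longlongrightarrow> 1) F"
proof -
  have "filterlim (\<lambda>c. inverse (\<phi> c)) at_top (at 0)"
    using phi_lim_0 phi_pos
    by (intro filterlim_inverse_at_top) (auto simp: eventually_at_filter)
  then have "filterlim (\<lambda>c. t / \<phi> c) at_top (at 0)"
    using filterlim_tendsto_pos_mult_at_top[OF tendsto_const t] by (simp add: divide_inverse)
  then have "((\<lambda>c. N x (t / \<phi> c)) \<longlongrightarrow> 1) (at 0)"
    by (rule filterlim_compose[OF bN5_lim])
  then have "((\<lambda>c. N (c *\<^sub>R x) t) \<longlongrightarrow> 1) (at 0)"
  proof (rule Lim_transform_eventually)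
    show "eventually (\<lambda>c. N x (t / \<phi> c) = N (c *\<^sub>R x) t) (at 0)"
      unfolding eventually_at_filter
    proof (intro always_eventually allI impI)
      fix c :: real assume "c \<noteq> 0"
      then show "N x (t / \<phi> c) = N (c *\<^sub>R x) t"
        using phi_pos[of c] by (simp add: bN3[OF t])
    qed
  qed
  \<comment> \<open>The punctured limit agrees with the value \<open>N 0 t = 1\<close>, so
    \<open>a\<close> may vanish along the filter.\<close>
  then have "isCont (\<lambda>c. N (c *\<^sub>R x) t) 0"
    by (simp add: isCont_def N_zero[OF t])
  from isCont_tendsto_compose[OF this a] show ?thesis
    by (simp add: N_zero[OF t])
qed

lemma fuzzy_converges_to_scaleR:
  assumes "a \<longlonglongrightarrow> c"
  shows "fuzzy_converges_to N (\<lambda>n. a n *\<^sub>R x) (c *\<^sub>R x)"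
  using tendsto_N_scaleR[of _ "\<lambda>n. a n - c" sequentially x] assms
  by (auto simp: fuzzy_converges_to_def scaleR_left_diff_distrib[symmetric] LIM_zero)

lemma fuzzy_converges_to_minus:
  assumes "fuzzy_converges_to N X x"
  shows "fuzzy_converges_to N (\<lambda>n. - X n) (- x)"
  unfolding fuzzy_converges_to_def
proof (intro allI impI)
  fix t :: real assume t: "t > 0"
  have "N (- X n - - x) t = N (X n - x) t" for n
    using N_minus[OF t, of "X n - x"] by simp
  then show "(\<lambda>n. N (- X n - - x) t) \<longlonglongrightarrow> 1"
    using assms t by (simp add: fuzzy_converges_to_def)
qed

text \<open>Division by \<open>a n\<close> replaces \<open>s\<close> by
  \<open>s * \<phi> (a n)\<close>, which eventually exceeds the single \<open>t\<close> that
  boundedness provides for all of \<open>A\<close>.\<close>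

lemma fuzzy_converges_to_scaled_bounded:
  assumes bdd: "fuzzy_bounded N A" and X: "\<And>n. X n \<in> A" and a: "filterlim a at_top sequentially"
  shows "fuzzy_converges_to N (\<lambda>n. X n /\<^sub>R a n) 0"
  unfolding fuzzy_converges_to_def
proof (intro allI impI)
  fix s :: real assume s: "s > 0"
  have "eventually (\<lambda>n. 1 - e < N (X n /\<^sub>R a n - 0) s) sequentially" if e: "e > 0" for e
  proof -
    \<comment> \<open>The cap 1/2 keeps \<open>r\<close> below 1, as \<open>fuzzy_bounded\<close>
      demands.\<close>
    define r where "r = min e (1/2)"
    have "0 < r" "r < 1"
      using e by (auto simp: r_def)
    with bdd obtain t where t: "t > 0" "\<And>x. x \<in> A \<Longrightarrow> N x t > 1 - r"
      unfolding fuzzy_bounded_def by blast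
    have "filterlim (\<lambda>n. \<phi> (a n)) at_top sequentially"
      by (rule filterlim_compose[OF phi_lim_infinity a])
    then have "eventually (\<lambda>n. \<phi> (a n) \<ge> t / s) sequentially"
      by (simp add: filterlim_at_top)
    moreover have "eventually (\<lambda>n. a n > 0) sequentially"
      using a by (simp add: filterlim_at_top_dense)
    ultimately show ?thesis
    proof eventually_elim
      case (elim n)
      have "\<phi> (a n) > 0" using elim by (intro phi_pos) auto
      have "1 - e \<le> 1 - r" by (simp add: r_def)
      also have "\<dots> < N (X n) t" using t(2) X by blast
      also have "\<dots> \<le> N (X n) (s * \<phi> (a n))"
        using elim s by (intro N_mono) (simp add: field_simps)
      also have "\<dots> = N (a n *\<^sub>R (X n /\<^sub>R a n)) (s * \<phi> (a n))" using elim by simp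
      also have "\<dots> = N (X n /\<^sub>R a n) s"
        using s \<open>\<phi> (a n) > 0\<close> by (subst bN3) auto
      finally show ?case by simp
    qed
  qed
  \<comment> \<open>A lower bound \<open>l < 1\<close> corresponds to \<open>e = 1 - l\<close>;
    upper bounds above 1 hold because \<open>N\<close> never exceeds 1.\<close>
  from this[of "1 - _"] show "(\<lambda>n. N (X n /\<^sub>R a n - 0) s) \<longlonglongrightarrow> 1"
    by (intro order_tendstoI) (auto intro: always_eventually le_less_trans[OF N_le_1])
qed

end

section \<open>Limits under a t-norm continuous at (1, 1)\<close>

locale fuzzy_space_continuous_t_norm = fuzzy_strong_phi_b_normed_space N \<phi> K T
  for N :: "'a::real_vector \<Rightarrow> real \<Rightarrow> real"
    and \<phi> :: "real \<Rightarrow> real"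
    and K :: real
    and T :: "real \<Rightarrow> real \<Rightarrow> real" +
  assumes T_continuous: "continuous (at (1, 1) within {0..1} \<times> {0..1}) (\<lambda>p. T (fst p) (snd p))"
begin

text \<open>Continuity is relative to the unit square, where \<open>f\<close> and \<open>g\<close>
  take their values; the limit is \<open>T 1 1 = 1\<close>.\<close>

lemma tendsto_T:
  assumes "(f \<longlongrightarrow> 1) F" "(g \<longlongrightarrow> 1) F"
    and "\<And>n. f n \<in> {0..1}" "\<And>n. g n \<in> {0..1}"
  shows "((\<lambda>n. T (f n) (g n)) \<longlongrightarrow> 1) F"
proof -
  have "((\<lambda>n. (f n, g n)) \<longlongrightarrow> (1, 1)) F"
    using assms by (intro tendsto_Pair)
  from continuous_within_tendsto_compose'[OF T_continuous _ this] show ?thesis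
    using assms T_one[of 1] by auto
qed

text \<open>The splitting \<open>t = t / 2 + K * (t / (2 * K))\<close> fits \<open>bN4\<close>,
  which squeezes the value between 1 and a t-norm of two quantities tending to 1.\<close>

lemma fuzzy_converges_to_add:
  assumes "fuzzy_converges_to N X x" "fuzzy_converges_to N Y y"
  shows "fuzzy_converges_to N (\<lambda>n. X n + Y n) (x + y)"
  unfolding fuzzy_converges_to_def
proof (intro allI impI)
  fix t :: real assume t: "t > 0"
  have "(\<lambda>n. T (N (X n - x) (t / 2)) (N (Y n - y) (t / (2 * K)))) \<longlonglongrightarrow> 1"
    using assms t K_ge_1 N_range by (intro tendsto_T) (auto simp: fuzzy_converges_to_def)
  then show "(\<lambda>n. N (X n + Y n - (x + y)) t) \<longlonglongrightarrow> 1"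
  proof (rule tendsto_sandwich[rotated 2])
    have "T (N (X n - x) (t / 2)) (N (Y n - y) (t / (2 * K))) \<le> N (X n + Y n - (x + y)) t" for n
      using bN4[of "X n - x" "t / 2" "Y n - y" "t / (2 * K)"] K_ge_1
      by (simp add: algebra_simps)
    then show "eventually (\<lambda>n. T (N (X n - x) (t / 2)) (N (Y n - y) (t / (2 * K)))
        \<le> N (X n + Y n - (x + y)) t) sequentially"
      by simp
  qed (auto simp: N_le_1)
qed

lemma fuzzy_converges_to_sum:
  assumes "finite B" "\<And>b. b \<in> B \<Longrightarrow> fuzzy_converges_to N (X b) (x b)"
  shows "fuzzy_converges_to N (\<lambda>n. \<Sum>b\<in>B. X b n) (\<Sum>b\<in>B. x b)"
  using assms
proof (induction B rule: finite_induct)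
  case empty
  then show ?case by (simp add: fuzzy_converges_to_def N_zero)
qed (simp add: fuzzy_converges_to_add)

text \<open>Subtracting the sequence from itself leaves the constant 0 converging to
  \<open>y - x\<close>; the resulting constant values of \<open>N\<close> must equal 1, and
  \<open>bN2\<close> applies.\<close>

lemma fuzzy_converges_to_unique:
  assumes "fuzzy_converges_to N X x" "fuzzy_converges_to N X y"
  shows "x = y"
proof -
  have "fuzzy_converges_to N (\<lambda>n. X n + - X n) (y + - x)"
    using assms by (intro fuzzy_converges_to_add fuzzy_converges_to_minus)
  then have "\<forall>t>0. N (x - y) t = 1"
    by (simp add: fuzzy_converges_to_def LIMSEQ_const_iff)
  then show ?thesis using bN2 by simp
qed

section \<open>Compact sets are closed and bounded\<close>

lemma fuzzy_compact_imp_closed: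
  assumes "fuzzy_compact N A"
  shows "fuzzy_closed N A"
  using assms fuzzy_converges_to_subseq fuzzy_converges_to_unique
  unfolding fuzzy_compact_def fuzzy_closed_def by metis

lemma fuzzy_compact_imp_bounded:
  assumes compact: "fuzzy_compact N A"
  shows "fuzzy_bounded N A"
proof (rule ccontr)
  assume "\<not> fuzzy_bounded N A"
  then obtain e where e: "0 < e" and not_bdd: "\<And>t. t > 0 \<Longrightarrow> \<exists>x\<in>A. N x t \<le> 1 - e"
    unfolding fuzzy_bounded_def by (meson not_le)
  \<comment> \<open>The parameter has the shape \<open>s + K * t\<close> of \<open>bN4\<close> with
    \<open>s = 1\<close> for the distance to the limit and \<open>t = real n\<close> for the limit
    itself.\<close>
  have "\<exists>x\<in>A. N x (1 + K * real n) \<le> 1 - e" for n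
    using not_bdd[of "1 + K * real n"] K_ge_1 by (simp add: add_pos_nonneg)
  then obtain X where X: "\<And>n. X n \<in> A" "\<And>n. N (X n) (1 + K * real n) \<le> 1 - e"
    by metis
  from compact X(1) obtain x r where r: "strict_mono r" "fuzzy_converges_to N (X \<circ> r) x"
    unfolding fuzzy_compact_def by blast
  have "(\<lambda>n. T (N (X (r n) - x) 1) (N x (real n))) \<longlonglongrightarrow> 1"
    using r(2) N_range filterlim_compose[OF bN5_lim filterlim_real_sequentially]
    by (intro tendsto_T) (auto simp: fuzzy_converges_to_def)
  then have "eventually (\<lambda>n. T (N (X (r n) - x) 1) (N x (real n)) > 1 - e) sequentially"
    using e by (intro order_tendstoD) auto
  then obtain n where n: "T (N (X (r n) - x) 1) (N x (real n)) > 1 - e"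
    by (auto dest: eventually_happens)
  note n
  also have "T (N (X (r n) - x) 1) (N x (real n)) \<le> N (X (r n)) (1 + K * real n)"
    using bN4[of "X (r n) - x" 1 x "real n"] by simp
  \<comment> \<open>Since \<open>n \<le> r n\<close>, monotonicity reaches the parameter at which
    \<open>X (r n)\<close> was chosen to be small.\<close>
  also have "\<dots> \<le> N (X (r n)) (1 + K * real (r n))"
    using K_ge_1 seq_suble[OF r(1), of n] by (intro N_mono) (simp add: mult_left_mono)
  also have "\<dots> \<le> 1 - e" by (rule X(2))
  finally show False by simp
qed

section \<open>Closed bounded sets are compact\<close>

lemma fuzzy_converges_to_representation:
  assumes B: "finite B" "independent B" "span B = UNIV"
    and "\<And>b. b \<in> B \<Longrightarrow> (\<lambda>n. representation B (X n) b) \<longlonglongrightarrow> representation B x b"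
  shows "fuzzy_converges_to N X x"
proof -
  have "fuzzy_converges_to N (\<lambda>n. \<Sum>b\<in>B. representation B (X n) b *\<^sub>R b)
      (\<Sum>b\<in>B. representation B x b *\<^sub>R b)"
    using assms by (intro fuzzy_converges_to_sum fuzzy_converges_to_scaleR)
  then show ?thesis
    using B by (simp add: real_vector.sum_representation_eq)
qed

lemma fuzzy_bounded_imp_bounded_representation:
  assumes B: "finite B" "independent B" "span B = UNIV" and bdd: "fuzzy_bounded N A"
  shows "\<exists>M. \<forall>x\<in>A. (\<Sum>b\<in>B. \<bar>representation B x b\<bar>) \<le> M"
proof -
  define L where "L x = (\<Sum>b\<in>B. \<bar>representation B x b\<bar>)" for x
  have "\<exists>M. \<forall>x\<in>A. L x \<le> M"
  proof (rule ccontr)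
    assume "\<nexists>M. \<forall>x\<in>A. L x \<le> M"
    \<comment> \<open>This bound makes every \<open>L (X n)\<close> positive, so that normalisation
      is possible, and also drives it to infinity.\<close>
    then have "\<exists>x\<in>A. real (Suc n) < L x" for n
      by (meson not_le)
    then obtain X where X: "\<And>n. X n \<in> A" "\<And>n. real (Suc n) < L (X n)"
      by metis
    have L_pos: "L (X n) > 0" for n
      by (rule le_less_trans[OF _ X(2)]) simp
    define Y where "Y n = X n /\<^sub>R L (X n)" for n
    have "filterlim (\<lambda>n. L (X n)) at_top sequentially"
    proof (intro filterlim_at_top_mono[OF filterlim_real_sequentially] always_eventually allI)
      show "real n \<le> L (X n)" for n
        using X(2)[of n] by linarith
    qed
    with bdd X(1) have Y_0: "fuzzy_converges_to N Y 0"
      unfolding Y_def by (rule fuzzy_converges_to_scaled_bounded)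
    have L_Y: "L (Y n) = 1" for n
    proof -
      have "L (Y n) = (\<Sum>b\<in>B. \<bar>representation B (X n) b\<bar> / L (X n))"
        using B L_pos[of n]
        by (simp add: L_def[of "X n /\<^sub>R L (X n)"] Y_def real_vector.representation_scale abs_mult divide_inverse mult.commute)
      also have "\<dots> = 1"
        using L_pos[of n] by (simp add: sum_divide_distrib[symmetric] L_def[symmetric])
      finally show ?thesis .
    qed
    obtain y r where r: "strict_mono r"
      and y: "\<And>b. b \<in> B \<Longrightarrow> (\<lambda>n. representation B (Y (r n)) b) \<longlonglongrightarrow> representation B y b"
      by (rule bounded_representation_subseq[OF B, of Y 1]) (use L_Y in \<open>auto simp: L_def\<close>)
    \<comment> \<open>\<open>L\<close> is a finite sum of absolute values of coordinates, hence
      passes to coordinatewise limits.\<close>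
    have "(\<lambda>n. L (Y (r n))) \<longlonglongrightarrow> L y"
      unfolding L_def by (intro tendsto_sum tendsto_rabs y)
    then have "L y = 1"
      by (simp add: L_Y LIMSEQ_const_iff)
    \<comment> \<open>The same subsequence tends to \<open>y\<close> by its coordinates and to 0 by
      boundedness of \<open>A\<close>.\<close>
    moreover have "y = 0"
    proof (rule fuzzy_converges_to_unique)
      show "fuzzy_converges_to N (Y \<circ> r) y"
        using B y by (intro fuzzy_converges_to_representation) auto
      show "fuzzy_converges_to N (Y \<circ> r) 0"
        using Y_0 r by (rule fuzzy_converges_to_subseq)
    qed
    ultimately show False
      by (simp add: L_def real_vector.representation_zero)
  qed
  then show ?thesis
    unfolding L_def .
qed

text \<open>Coordinate bounds give a coordinatewise convergent subsequence, which also converges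
  fuzzily; closedness keeps its limit in \<open>A\<close>.\<close>

lemma fuzzy_closed_bounded_imp_compact:
  fixes A B :: "'a set"
  assumes B: "finite B" "independent B" "span B = UNIV"
    and closed: "fuzzy_closed N A" and bdd: "fuzzy_bounded N A"
  shows "fuzzy_compact N A"
  unfolding fuzzy_compact_def
proof (intro allI impI)
  fix X :: "nat \<Rightarrow> 'a" assume X: "\<forall>n. X n \<in> A"
  obtain M where M: "\<forall>x\<in>A. (\<Sum>b\<in>B. \<bar>representation B x b\<bar>) \<le> M"
    using fuzzy_bounded_imp_bounded_representation[OF B bdd] by blast
  obtain x r where r: "strict_mono r"
    and lim: "\<And>b. b \<in> B \<Longrightarrow> (\<lambda>n. representation B (X (r n)) b) \<longlonglongrightarrow> representation B x b"
    by (rule bounded_representation_subseq[OF B, of X M]) (use M X in auto)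
  have "fuzzy_converges_to N (X \<circ> r) x"
    using B lim by (intro fuzzy_converges_to_representation) auto
  moreover from this have "x \<in> A"
    using closed X unfolding fuzzy_closed_def by (metis comp_apply)
  ultimately show "\<exists>x\<in>A. \<exists>r. strict_mono r \<and> fuzzy_converges_to N (X \<circ> r) x"
    using r by blast
qed

end

theorem theorem4p3:
  fixes N :: "'a::real_vector \<Rightarrow> real \<Rightarrow> real"
    and \<phi> :: "real \<Rightarrow> real"
    and K :: real
    and T :: "real \<Rightarrow> real \<Rightarrow> real"
    and A :: "'a set"
  assumes "fuzzy_strong_phi_b_normed_space N \<phi> K T"
    and "\<exists>B :: 'a set. finite B \<and> span B = UNIV"
    and "continuous (at (1, 1) within {0..1} \<times> {0..1}) (\<lambda>p. T (fst p) (snd p))"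
  shows "fuzzy_compact N A \<longleftrightarrow> fuzzy_closed N A \<and> fuzzy_bounded N A"
proof -
  interpret fuzzy_space_continuous_t_norm N \<phi> K T
    using assms(1,3)
    by (simp add: fuzzy_space_continuous_t_norm_def fuzzy_space_continuous_t_norm_axioms_def)
  obtain S :: "'a set" where S: "finite S" "span S = UNIV"
    using assms(2) by blast
  \<comment> \<open>A basis is selected inside the finite spanning set, so it inherits
    finiteness.\<close>
  obtain B where B: "B \<subseteq> S" "independent B" "S \<subseteq> span B"
    using real_vector.maximal_independent_subset by blast
  have "span B = UNIV"
    using real_vector.span_minimal[OF B(3)] S(2) by auto
  moreover have "finite B"
    using B(1) S(1) by (rule finite_subset)
  ultimately show ?thesis
    using B(2) fuzzy_compact_imp_closed fuzzy_compact_imp_bounded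
      fuzzy_closed_bounded_imp_compact[of B A] by blast
qed

end
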